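(* $gr^3_2(B_{12})=20$.
   Context: $K_n$ is the complete graph of order $n$. The book $B_n:=K_2+nK_1$ (graph join) is the graph on $n+2$ vertices consisting of an edge $xy$ (the spine) together with $n$ further, pairwise non-adjacent vertices (the pages), each adjacent to both $x$ and $y$. A $t$-coloring of $K_p$ is a map $f:E(K_p)\to\{1,\dots,t\}$, not assumed surjective. A Gallai $t$-coloring is a $t$-coloring with no rainbow triangle, i.e. there are no three vertices $x,y,z$ such that $f(xy),f(xz),f(yz)$ are pairwise distinct. For $1\le s<t$ and a graph $G$, the weakened Gallai-Ramsey number $gr^t_s(G)$ is the least $p\in\mathbb{N}$ such that every Gallai $t$-coloring of $K_p$ contains a (not necessarily induced) subgraph isomorphic to $G$ whose edges use at most $s$ colors. *)

theory Defs
  imports Main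
begin

text \<open>
  Simple graphs are pairs of a vertex set and a set of edges, each edge being an unordered
  pair of distinct vertices.
\<close>

type_synonym 'a graph = "'a set \<times> 'a set set"

abbreviation vertices :: "'a graph \<Rightarrow> 'a set" where
  "vertices G \<equiv> fst G"

abbreviation edges :: "'a graph \<Rightarrow> 'a set set" where
  "edges G \<equiv> snd G"

definition all_pairs :: "'a set \<Rightarrow> 'a set set" where
  "all_pairs V = {{u, v} | u v. u \<in> V \<and> v \<in> V \<and> u \<noteq> v}"

definition simple_graph :: "'a graph \<Rightarrow> bool" where
  "simple_graph G \<longleftrightarrow> edges G \<subseteq> all_pairs (vertices G)"

definition subgraph :: "'a graph \<Rightarrow> 'a graph \<Rightarrow> bool" where
  "subgraph H G \<longleftrightarrow> simple_graph H \<and> vertices H \<subseteq> vertices G \<and> edges H \<subseteq> edges G"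

definition isomorphic :: "'a graph \<Rightarrow> 'b graph \<Rightarrow> bool" where
  "isomorphic G H \<longleftrightarrow>
     (\<exists>\<phi>. bij_betw \<phi> (vertices G) (vertices H) \<and> edges H = (\<lambda>e. \<phi> ` e) ` edges G)"

definition complete_graph :: "nat \<Rightarrow> nat graph" where
  "complete_graph p = ({..<p}, all_pairs {..<p})"

definition empty_graph :: "nat \<Rightarrow> nat graph" where
  "empty_graph n = ({..<n}, {})"

definition graph_join :: "'a graph \<Rightarrow> 'b graph \<Rightarrow> ('a + 'b) graph" where
  "graph_join G H =
     (vertices G <+> vertices H,
      (\<lambda>e. Inl ` e) ` edges G \<union> (\<lambda>e. Inr ` e) ` edges H
        \<union> {{Inl u, Inr v} | u v. u \<in> vertices G \<and> v \<in> vertices H})"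

definition book :: "nat \<Rightarrow> (nat + nat) graph" where
  "book n = graph_join (complete_graph 2) (empty_graph n)"

text \<open>
  Colorings are functions on all sets of vertices; only their values on the edges of the
  complete graph matter.
\<close>

definition coloring :: "nat \<Rightarrow> nat \<Rightarrow> (nat set \<Rightarrow> nat) \<Rightarrow> bool" where
  "coloring t p f \<longleftrightarrow> (\<forall>e \<in> edges (complete_graph p). f e \<in> {1..t})"

definition rainbow_triangle :: "(nat set \<Rightarrow> nat) \<Rightarrow> nat \<Rightarrow> nat \<Rightarrow> nat \<Rightarrow> bool" where
  "rainbow_triangle f x y z \<longleftrightarrow>
     x \<noteq> y \<and> x \<noteq> z \<and> y \<noteq> z \<and>
     f {x, y} \<noteq> f {x, z} \<and> f {x, y} \<noteq> f {y, z} \<and> f {x, z} \<noteq> f {y, z}"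

definition gallai_coloring :: "nat \<Rightarrow> nat \<Rightarrow> (nat set \<Rightarrow> nat) \<Rightarrow> bool" where
  "gallai_coloring t p f \<longleftrightarrow> coloring t p f \<and>
     \<not> (\<exists>x \<in> vertices (complete_graph p). \<exists>y \<in> vertices (complete_graph p).
          \<exists>z \<in> vertices (complete_graph p). rainbow_triangle f x y z)"

definition has_copy_with_colors :: "nat \<Rightarrow> 'a graph \<Rightarrow> nat \<Rightarrow> (nat set \<Rightarrow> nat) \<Rightarrow> bool" where
  "has_copy_with_colors s G p f \<longleftrightarrow>
     (\<exists>H. subgraph H (complete_graph p) \<and> isomorphic G H \<and> card (f ` edges H) \<le> s)"

text \<open>
  The weakened Gallai-Ramsey number, intended for \<open>1 \<le> s < t\<close> and finite simple \<open>G\<close>;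
  the value is unspecified if no suitable \<open>p\<close> exists.
\<close>

definition weakened_gallai_ramsey :: "nat \<Rightarrow> nat \<Rightarrow> 'a graph \<Rightarrow> nat" where
  "weakened_gallai_ramsey t s G =
     (LEAST p. \<forall>f. gallai_coloring t p f \<longrightarrow> has_copy_with_colors s G p f)"

end

theory Submission
  imports Defs
begin

text \<open>
  A coloring of \<open>K\<^sub>2\<^sub>0\<close> has no copy of the book in two colors iff for every edge \<open>xy\<close> not
  colored \<open>k\<close> at least 7 vertices are joined to \<open>x\<close> or \<open>y\<close> in color \<open>k\<close>. In a Gallai
  3-coloring some color \<open>k\<close> is disconnected, and only one color occurs between two of its components.

  No proper vertex set \<open>B\<close> sends edges of a single color to its complement. If it did, all the
  vertices demanded in the other two colors would lie inside, so the smaller side would have 1, 9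
  or 10 vertices. With 9 or 10 vertices it is 2-colored with too few monochromatic triangles.
  With a single vertex, a disconnected color on the other 19 has either a side of at most 9 vertices
  with too few neighbours in the color of its edges to
  that vertex, or at least five components of total size above 19.

  So between the components of color \<open>k\<close> on all 20 vertices both other colors are connected, which
  takes at least four components. Any two have at least 9 vertices together. There are therefore exactly
  four, each with at most 6 vertices and hence a clique in color \<open>k\<close>. Seen from a vertex of one of
  them, some color other than \<open>k\<close> reaches at most one further component, hence fewer than 7 vertices.

  For the lower bound, join in color 3 a Paley coloring of 9 vertices (the \<open>3 \<times> 3\<close> rook graph
  and its complement) to the restriction to 10 vertices of the Paley coloring of order 13.
\<close>

section \<open>Labels for the three colors, and a count for disjoint sets\<close>

definition trio :: "nat \<Rightarrow> nat \<Rightarrow> nat \<Rightarrow> bool" where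
  "trio i j k \<longleftrightarrow> {i, j, k} = {1, 2, 3} \<and> i \<noteq> j \<and> i \<noteq> k \<and> j \<noteq> k"

lemma trio_swap: "trio i j k \<Longrightarrow> trio j i k"
  by (auto simp: trio_def)

lemma trioD:
  assumes "trio i j k"
  shows "i \<in> {1, 2, 3}" "j \<in> {1, 2, 3}" "k \<in> {1, 2, 3}"
    and "i \<noteq> j" "i \<noteq> k" "j \<noteq> k" "j \<noteq> i" "k \<noteq> i" "k \<noteq> j"
  using assms unfolding trio_def by blast+

lemma trio_exists:
  assumes "k \<in> {1, 2, 3}" obtains i j where "trio i j k"
proof -
  have "trio 2 3 1" "trio 1 3 2" "trio 1 2 3" by (auto simp: trio_def)
  then show thesis using assms that by blast
qed

text \<open>Serves to bound the number of components; four disjoint sets are treated by taking the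
  fifth one empty.\<close>

lemma sum_card_disjoint_five:
  assumes "finite S" "A1 \<union> A2 \<union> A3 \<union> A4 \<union> A5 \<subseteq> S"
    and "A1 \<inter> A2 = {}" "A1 \<inter> A3 = {}" "A1 \<inter> A4 = {}" "A1 \<inter> A5 = {}" "A2 \<inter> A3 = {}"
    and "A2 \<inter> A4 = {}" "A2 \<inter> A5 = {}" "A3 \<inter> A4 = {}" "A3 \<inter> A5 = {}" "A4 \<inter> A5 = {}"
  shows "card A1 + card A2 + card A3 + card A4 + card A5 \<le> card S"
proof -
  have fin: "finite A1" "finite A2" "finite A3" "finite A4" "finite A5"
    using assms(1,2) by (auto dest: finite_subset)
  have "card (A1 \<union> A2 \<union> A3 \<union> A4 \<union> A5) = card A1 + card A2 + card A3 + card A4 + card A5"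
    using fin assms(3-) by (simp add: card_Un_disjoint Int_Un_distrib2)
  then show ?thesis using card_mono[OF assms(1,2)] by simp
qed

lemma third_color: "\<exists>l\<in>{1, 2, 3::nat}. l \<noteq> k \<and> l \<noteq> m"
  by (cases "k = 1"; cases "m = 1"; cases "k = 2"; cases "m = 2") auto

section \<open>Components of one color in a Gallai 3-coloring\<close>

locale gallai_three =
  fixes V :: "'a set" and c :: "'a \<Rightarrow> 'a \<Rightarrow> nat"
  assumes finite_V: "finite V"
    and c_sym: "c x y = c y x"
    and c_range: "\<lbrakk>x \<in> V; y \<in> V; x \<noteq> y\<rbrakk> \<Longrightarrow> c x y \<in> {1, 2, 3}"
    and no_rainbow: "\<lbrakk>x \<in> V; y \<in> V; z \<in> V; x \<noteq> y; x \<noteq> z; y \<noteq> z\<rbrakk> \<Longrightarrow>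
      c x y = c x z \<or> c x y = c y z \<or> c x z = c y z"
begin

text \<open>The closure is reflexive on the whole type, so a point outside \<open>S\<close> is
  related to itself only.\<close>

definition conn :: "nat \<Rightarrow> 'a set \<Rightarrow> ('a \<times> 'a) set" where
  "conn k S = {(x, y). x \<in> S \<and> y \<in> S \<and> x \<noteq> y \<and> c x y = k}\<^sup>*"

lemma conn_refl [simp]: "(x, x) \<in> conn k S"
  by (simp add: conn_def)

lemma conn_trans: "(x, y) \<in> conn k S \<Longrightarrow> (y, z) \<in> conn k S \<Longrightarrow> (x, z) \<in> conn k S"
  unfolding conn_def by (rule rtrancl_trans)

lemma conn_sym: "(x, y) \<in> conn k S \<Longrightarrow> (y, x) \<in> conn k S"
proof -
  have "sym {(x, y). x \<in> S \<and> y \<in> S \<and> x \<noteq> y \<and> c x y = k}"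
    by (auto intro!: symI simp: c_sym)
  then show "(x, y) \<in> conn k S \<Longrightarrow> (y, x) \<in> conn k S"
    unfolding conn_def by (meson sym_rtrancl symD)
qed

lemma conn_edge: "\<lbrakk>x \<in> S; y \<in> S; c x y = k\<rbrakk> \<Longrightarrow> (x, y) \<in> conn k S"
  unfolding conn_def by (cases "x = y") auto

lemma conn_mem: "(x, y) \<in> conn k S \<Longrightarrow> x \<in> S \<Longrightarrow> y \<in> S"
  unfolding conn_def by (induction rule: rtrancl_induct) auto

lemma color_cases:
  assumes "x \<in> V" "y \<in> V" "x \<noteq> y" "trio i j k"
  shows "c x y = i \<or> c x y = j \<or> c x y = k"
proof -
  have "c x y \<in> {i, j, k}" using c_range[OF assms(1-3)] assms(4) by (simp add: trio_def)
  then show ?thesis by simp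
qed

lemma nonconn_color:
  assumes "S \<subseteq> V" "x \<in> S" "y \<in> S" "(x, y) \<notin> conn k S" "trio i j k"
  shows "c x y = i \<or> c x y = j"
proof -
  have "x \<noteq> y" "c x y \<noteq> k" using assms conn_edge by auto
  then show ?thesis using color_cases[of x y i j k] assms by auto
qed

text \<open>Along a path in color \<open>k\<close> from \<open>y\<close>, no vertex is joined to
  \<open>x\<close> in color \<open>k\<close>. For an edge \<open>u w\<close> of the path, the
  triangle \<open>x u w\<close> is not rainbow, so its two edges at \<open>x\<close> have equal
  color.\<close>

lemma color_constant:
  assumes "S \<subseteq> V" "x \<in> S" "y \<in> S" "(x, y) \<notin> conn k S" "(y, z) \<in> conn k S"
  shows "c x z = c x y"
  using assms(5)[unfolded conn_def]
proof (induction rule: rtrancl_induct)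
  case base
  then show ?case by simp
next
  case (step u w)
  have yu: "(y, u) \<in> conn k S" "(y, w) \<in> conn k S"
    using step.hyps unfolding conn_def by (auto intro: rtrancl_into_rtrancl)
  then have n: "(x, u) \<notin> conn k S" "(x, w) \<notin> conn k S"
    using assms(4) conn_sym conn_trans by meson+
  then have "c x u \<noteq> k" "c x w \<noteq> k" "x \<noteq> u" "x \<noteq> w"
    using step.hyps assms(2) conn_edge by auto
  moreover have "x \<in> V" "u \<in> V" "w \<in> V" "u \<noteq> w" "c u w = k"
    using step.hyps assms(1,2) by auto
  ultimately show ?case
    using no_rainbow[of x u w] step.IH by auto
qed

lemma color_constant2:
  assumes "S \<subseteq> V" "x \<in> S" "y \<in> S" "(x, y) \<notin> conn k S"
    and "(x, x') \<in> conn k S" "(y, y') \<in> conn k S"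
  shows "c x' y' = c x y"
proof -
  have "(x', y) \<notin> conn k S" using assms conn_trans by meson
  then have "c x' y' = c x' y"
    using color_constant[of S x' y k y'] conn_mem assms by auto
  moreover have "c y x' = c y x"
    using color_constant[of S y x k x'] conn_sym assms by blast
  ultimately show ?thesis by (simp add: c_sym)
qed

text \<open>Contrapositive of \<open>color_constant\<close>: two different colors seen from
  \<open>x\<close> certify two different components.\<close>

lemma nonconn_by_color:
  assumes "S \<subseteq> V" "x \<in> S" "y \<in> S" "(x, y) \<notin> conn k S" "c x z \<noteq> c x y"
  shows "(y, z) \<notin> conn k S"
  using color_constant assms by blast

text \<open>A path can leave \<open>S\<close> only through \<open>v\<close>; its part before the
  first visit to \<open>v\<close> stays in \<open>S\<close> and ends at a neighbour of
  \<open>v\<close> in color \<open>k\<close>.\<close>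

lemma conn_insert:
  assumes "(u, t) \<in> conn k (insert v S)" "u \<in> S"
  shows "(t \<in> S \<and> (u, t) \<in> conn k S) \<or> (\<exists>w\<in>S. (u, w) \<in> conn k S \<and> c w v = k)"
  using assms(1)[unfolded conn_def]
proof (induction rule: rtrancl_induct)
  case base
  then show ?case using assms(2) by simp
next
  case (step y z)
  show ?case
  proof (cases "y \<in> S \<and> (u, y) \<in> conn k S")
    case True
    show ?thesis
    proof (cases "z \<in> S")
      case zS: True
      then have "(y, z) \<in> conn k S" using True step.hyps conn_edge by auto
      then show ?thesis using True conn_trans zS by blast
    next
      case False
      then show ?thesis using True step.hyps by auto
    qed
  next
    case False
    then show ?thesis using step.IH by blast
  qed
qed

lemma conn_no_edge:
  assumes "(v, u) \<in> conn k S" "\<And>w. \<lbrakk>w \<in> S; w \<noteq> v\<rbrakk> \<Longrightarrow> c v w \<noteq> k"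
  shows "u = v"
  using assms(1)[unfolded conn_def] by (cases rule: converse_rtranclE) (auto dest: assms(2))

text \<open>
  If deleting \<open>v\<close> disconnects color \<open>k\<close>, then \<open>v\<close> sends an edge of color \<open>k\<close> to each
  component; as there is no rainbow triangle, all the other edges at \<open>v\<close> have one common color.
\<close>

lemma disconnected_color:
  assumes "S \<subseteq> V" "2 \<le> card S"
  shows "\<exists>k\<in>{1, 2, 3}. \<exists>x\<in>S. \<exists>y\<in>S. (x, y) \<notin> conn k S"
proof -
  have "finite S" using assms(1) finite_V finite_subset by blast
  then show ?thesis using assms
  proof (induction S rule: finite_induct)
    case empty
    then show ?case by simp
  next
    case (insert v S)
    show ?case
    proof (cases "2 \<le> card S")
      case False
      then have "card S = 1" using insert by simp
      then obtain u where S: "S = {u}" using card_1_singletonE by blast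
      have "\<exists>k::nat\<in>{1, 2, 3}. k \<noteq> c v u" by (cases "c v u = 1") auto
      then obtain k where k: "k \<in> {1, 2, 3}" "k \<noteq> c v u" by blast
      have "u \<noteq> v" using insert.hyps S by auto
      then have "(v, u) \<notin> conn k (insert v S)"
        using conn_no_edge[of v u k "insert v S"] k S by auto
      then show ?thesis using k S by blast
    next
      case True
      have SV: "S \<subseteq> V" "v \<in> V" using insert.prems by auto
      obtain k x y where k: "k \<in> {1, 2, 3}" and xy: "x \<in> S" "y \<in> S" "(x, y) \<notin> conn k S"
        using insert.IH[OF SV(1) True] by blast
      show ?thesis
      proof (rule ccontr)
        assume "\<not> ?thesis"
        then have all: "(a, b) \<in> conn l (insert v S)"
          if "l \<in> {1, 2, 3}" "a \<in> insert v S" "b \<in> insert v S" for a b l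
          using that by blast
        have reach: "\<exists>w\<in>S. (u, w) \<in> conn k S \<and> c w v = k" if "u \<in> S" for u
          using conn_insert[of u v k v S] all[of k u v] that k insert.hyps by auto
        \<comment> \<open>Here \<open>w\<close> is a neighbour of \<open>v\<close> in color
          \<open>k\<close> in the component of \<open>z\<close>. The triangle \<open>v u w\<close>
          gives \<open>c u w = c v u\<close>, and this color carries over from \<open>w\<close> to
          \<open>z\<close>.\<close>
        have key: "c z u = c v u" if u: "u \<in> S" "c v u \<noteq> k" and z: "z \<in> S" "(u, z) \<notin> conn k S"
          for u z
        proof -
          obtain w where w: "w \<in> S" "(z, w) \<in> conn k S" "c w v = k" using reach z by blast
          have uw: "(u, w) \<notin> conn k S" using w z conn_sym conn_trans by meson
          then have "c u w \<noteq> k" "u \<noteq> w" using conn_edge u w by auto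
          moreover have "u \<in> V" "w \<in> V" "v \<noteq> u" "v \<noteq> w" using u w SV insert.hyps by auto
          ultimately have "c u w = c v u"
            using no_rainbow[of v u w] u w SV c_sym[of v w] by auto
          moreover have "c u z = c u w"
            using color_constant[OF SV(1) u(1) w(1) uw] w(2) conn_sym by blast
          ultimately show ?thesis by (simp add: c_sym)
        qed
        have uniq: "c v u = c v u'" if u: "u \<in> S" "c v u \<noteq> k" "u' \<in> S" "c v u' \<noteq> k" for u u'
        proof (cases "(u, u') \<in> conn k S")
          case False
          then have "(u', u) \<notin> conn k S" using conn_sym by blast
          then show ?thesis using key[of u u'] key[of u' u] False u c_sym[of u u'] by auto
        next
          case True
          \<comment> \<open>Two vertices of one component are compared through a vertex
            \<open>z\<close> of another, whose edges to both have the same color.\<close>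
          obtain z where z: "z \<in> S" "(u, z) \<notin> conn k S"
            using xy conn_sym conn_trans by meson
          then have z': "(u', z) \<notin> conn k S" using True conn_trans by blast
          have "c z u' = c z u"
            using color_constant[OF SV(1) z(1) u(1) _ True] z conn_sym by blast
          then show ?thesis using key[of u z] key[of u' z] u z z' by auto
        qed
        \<comment> \<open>If both colors other than \<open>k\<close> occurred at \<open>v\<close>,
          \<open>uniq\<close> would equate them; so \<open>v\<close> is isolated in some color
          \<open>l\<close>.\<close>
        obtain l where l: "l \<in> {1, 2, 3}" "\<And>u. u \<in> S \<Longrightarrow> c v u \<noteq> l"
        proof -
          obtain i j where ij: "trio i j k" using trio_exists k by blast
          then have "i \<in> {1, 2, 3}" "j \<in> {1, 2, 3}" "i \<noteq> j" "i \<noteq> k" "j \<noteq> k"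
            by (auto simp: trio_def)
          then show thesis using uniq that by metis
        qed
        have "x = v"
          using conn_no_edge[of v x l "insert v S"] all[of l v x] l xy by auto
        then show False using xy insert.hyps by simp
      qed
    qed
  qed
qed

section \<open>Neighbourhoods in one color\<close>

definition nbr :: "nat \<Rightarrow> 'a \<Rightarrow> 'a set" where
  "nbr k x = {z \<in> V. z \<noteq> x \<and> c x z = k}"

lemma finite_nbr [simp]: "finite (nbr k x)"
  using finite_V by (simp add: nbr_def)

lemma nbr_partition:
  assumes "trio i j k" "x \<in> V"
  shows "V - {x} = nbr i x \<union> nbr j x \<union> nbr k x"
  using c_range[OF assms(2)] assms(1) by (auto simp: nbr_def trio_def)

lemma nbr_disjoint: "i \<noteq> j \<Longrightarrow> nbr i x \<inter> nbr j x = {}"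
  by (auto simp: nbr_def)

lemma nbr_sum:
  assumes "trio i j k" "x \<in> V"
  shows "card (nbr i x) + card (nbr j x) + card (nbr k x) = card V - 1"
proof -
  have "i \<noteq> j" "i \<noteq> k" "j \<noteq> k" using assms by (auto simp: trio_def)
  then have "card (nbr i x \<union> nbr j x \<union> nbr k x) = card (nbr i x) + card (nbr j x) + card (nbr k x)"
    by (subst card_Un_disjoint; (simp add: card_Un_disjoint nbr_disjoint Int_Un_distrib2)?)
  then show ?thesis using nbr_partition[OF assms] assms(2) finite_V
    by (metis card_Diff_singleton)
qed

lemma nbr_conn:
  assumes "x \<in> S" shows "nbr k x \<inter> S \<subseteq> {z. (x, z) \<in> conn k S}"
  using assms conn_edge by (auto simp: nbr_def)

lemma closed_nbr_disjoint:
  assumes "x \<in> S" "y \<in> S" "(x, y) \<notin> conn k S"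
  shows "insert x (nbr k x \<inter> S) \<inter> insert y (nbr k y \<inter> S) = {}"
proof -
  have "(x, z) \<in> conn k S" if "z \<in> insert x (nbr k x \<inter> S)" for z
    using that assms(1) by (auto simp: nbr_def intro: conn_edge)
  moreover have "(z, y) \<in> conn k S" if "z \<in> insert y (nbr k y \<inter> S)" for z
    using that assms(2) by (intro conn_sym[of y]) (auto simp: nbr_def intro: conn_edge)
  ultimately show ?thesis using assms(3) conn_trans[of x _ k S y] by blast
qed

text \<open>Closed neighbourhoods of vertices in different components are disjoint, and each vertex
  counts itself, whence the 5. Lower bounds on degrees then exclude a fifth component.\<close>

lemma five_nonconn_sum:
  assumes "S \<subseteq> V" "{x, y, z, w, u} \<subseteq> S"
    and "(x, y) \<notin> conn k S" "(x, z) \<notin> conn k S" "(x, w) \<notin> conn k S" "(x, u) \<notin> conn k S"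
    and "(y, z) \<notin> conn k S" "(y, w) \<notin> conn k S" "(y, u) \<notin> conn k S"
    and "(z, w) \<notin> conn k S" "(z, u) \<notin> conn k S" "(w, u) \<notin> conn k S"
  shows "card (nbr k x \<inter> S) + card (nbr k y \<inter> S) + card (nbr k z \<inter> S)
    + card (nbr k w \<inter> S) + card (nbr k u \<inter> S) + 5 \<le> card S"
proof -
  have fS: "finite S" using assms(1) finite_V finite_subset by blast
  define A where "A t = insert t (nbr k t \<inter> S)" for t
  have c: "card (A t) = card (nbr k t \<inter> S) + 1" for t
    using fS by (simp add: A_def nbr_def)
  have d: "A a \<inter> A b = {}" if "a \<in> S" "b \<in> S" "(a, b) \<notin> conn k S" for a b
    unfolding A_def by (rule closed_nbr_disjoint[OF that])
  have "card (A x) + card (A y) + card (A z) + card (A w) + card (A u) \<le> card S"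
    by (rule sum_card_disjoint_five[OF fS]; (rule d)?; (use assms in \<open>auto simp: A_def\<close>)?)
  then show ?thesis unfolding c by simp
qed

end

section \<open>A parity argument on five vertices\<close>

text \<open>By \<open>1\<close> the graph \<open>P\<close> has maximum degree one on
  \<open>T\<close>. By \<open>2\<close> its complement has no two triangles sharing an edge, which
  excludes isolated vertices. So \<open>P\<close> would be a perfect matching of an odd set.\<close>

lemma no_matching_on_five:
  assumes card: "card T = 5" and sym: "\<And>x y. P x y \<Longrightarrow> P y x"
    and 1: "\<And>x y z. \<lbrakk>x \<in> T; y \<in> T; z \<in> T; x \<noteq> y; x \<noteq> z; y \<noteq> z; P x y; P x z\<rbrakk> \<Longrightarrow> False"
    and 2: "\<And>x y z w. \<lbrakk>x \<in> T; y \<in> T; z \<in> T; w \<in> T; distinct [x, y, z, w];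
      \<not> P x y; \<not> P x z; \<not> P y z; \<not> P x w; \<not> P y w\<rbrakk> \<Longrightarrow> False"
  shows False
proof -
  have fT: "finite T" using card by (simp add: card_ge_0_finite)
  have pick: "\<exists>z\<in>T. z \<notin> set xs" if "length xs < 5" for xs
    using that card card_length[of xs] card_mono[of "set xs" T] by fastforce
  have partner: "\<exists>y\<in>T. y \<noteq> x \<and> P x y" if x: "x \<in> T" for x
  proof (rule ccontr)
    assume none: "\<not> ?thesis"
    \<comment> \<open>Of the three vertices other than \<open>x\<close> and \<open>y\<close>, at
      most one is joined to \<open>y\<close>; the other two form complementary triangles on the edge
      \<open>x y\<close>.\<close>
    obtain y where y: "y \<in> T" "y \<noteq> x" using pick[of "[x]"] by auto
    have "card (T - {x, y}) = 3" using x y card by (simp add: card_Diff_subset)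
    then obtain p q r where "T - {x, y} = {p, q, r}" and d: "p \<noteq> q" "p \<noteq> r" "q \<noteq> r"
      by (auto simp: card_3_iff)
    then have m: "p \<in> T" "q \<in> T" "r \<in> T" "p \<noteq> x" "q \<noteq> x" "r \<noteq> x" "p \<noteq> y" "q \<noteq> y" "r \<noteq> y"
      by blast+
    have "\<not> (P y p \<and> P y q)" "\<not> (P y p \<and> P y r)" "\<not> (P y q \<and> P y r)"
      using 1[of y p q] 1[of y p r] 1[of y q r] m d y by auto
    moreover have "\<not> P x p" "\<not> P x q" "\<not> P x r" "\<not> P x y" using none m y by auto
    ultimately show False
      using 2[of x y p q] 2[of x y p r] 2[of x y q r] m d x y by auto
  qed
  obtain a where a: "a \<in> T" using pick[of "[]"] by auto
  obtain b where b: "b \<in> T" "b \<noteq> a" "P a b" using partner a by blast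
  obtain c where c: "c \<in> T" "c \<noteq> a" "c \<noteq> b" using pick[of "[a, b]"] by auto
  obtain d where d: "d \<in> T" "d \<noteq> c" "P c d" using partner c by blast
  have d': "d \<noteq> a" "d \<noteq> b" using 1[of a b c] 1[of b a c] a b c d sym by blast+
  obtain e where e: "e \<in> T" "e \<noteq> a" "e \<noteq> b" "e \<noteq> c" "e \<noteq> d" using pick[of "[a, b, c, d]"] by auto
  obtain f where f: "f \<in> T" "f \<noteq> e" "P e f" using partner e by blast
  have "{a, b, c, d, e} = T"
    by (rule card_subset_eq[OF fT]) (use a b c d d' e card in auto)
  then have "f \<in> {a, b, c, d}" using f by auto
  then show False
    using 1[of a b e] 1[of b a e] 1[of c d e] 1[of d c e] a b c d e f sym by blast
qed

section \<open>Colorings of 20 vertices without a two-colored book\<close>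

text \<open>Call a vertex touched if it is joined to \<open>x\<close> or \<open>y\<close> in color
  \<open>k\<close>. The untouched ones among the other 18 vertices are the possible pages of a book
  without color \<open>k\<close>; there are at most 11 exactly if at least 7 are touched.\<close>

locale touching_coloring = gallai_three +
  assumes card_V: "card V = 20"
    and touch: "\<lbrakk>x \<in> V; y \<in> V; x \<noteq> y; k \<in> {1, 2, 3}; c x y \<noteq> k\<rbrakk> \<Longrightarrow>
      7 \<le> card (nbr k x \<union> nbr k y)"
begin

lemma touch_sum:
  assumes "x \<in> V" "y \<in> V" "x \<noteq> y" "k \<in> {1, 2, 3}" "c x y \<noteq> k"
  shows "7 \<le> card (nbr k x) + card (nbr k y)"
  using touch[OF assms] card_Un_le[of "nbr k x" "nbr k y"] by linarith

section \<open>A vertex whose edges all have one color\<close>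

context
  fixes v i j k
  assumes v: "v \<in> V" and ijk: "trio i j k"
    and apex: "\<And>x. \<lbrakk>x \<in> V; x \<noteq> v\<rbrakk> \<Longrightarrow> c v x = k"
begin

text \<open>As \<open>v\<close> has no neighbour in color \<open>l\<close>, the 7 vertices touched
  by the pair \<open>x\<close>, \<open>v\<close> are all neighbours of \<open>x\<close>.\<close>

lemma cone_degree:
  assumes "x \<in> V - {v}" "l \<in> {1, 2, 3}" "l \<noteq> k"
  shows "7 \<le> card (nbr l x)" "nbr l x \<subseteq> V - {v}"
proof -
  have "nbr l v = {}" using assms apex by (auto simp: nbr_def)
  then show "7 \<le> card (nbr l x)" using touch_sum[of x v l] apex[of x] assms v c_sym[of x v] by auto
  show "nbr l x \<subseteq> V - {v}" using apex[of x] assms c_sym[of x v] by (auto simp: nbr_def)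
qed

lemma cone_apex_mem:
  assumes "x \<in> V - {v}" shows "v \<in> nbr k x"
  using assms apex[of x] v c_sym[of x v] by (auto simp: nbr_def)

text \<open>The two other colors take at least 14 of the 19 edges at \<open>x\<close>, and one of
  the remaining edges goes to \<open>v\<close>.\<close>

lemma cone_degree_k:
  assumes "x \<in> V - {v}" shows "card (nbr k x - {v}) \<le> 4"
proof -
  have "card (nbr k x) \<le> 5"
    using nbr_sum[OF ijk, of x] cone_degree(1)[OF assms trioD(1,5)[OF ijk]]
      cone_degree(1)[OF assms trioD(2,6)[OF ijk]] assms card_V by simp
  then show ?thesis using cone_apex_mem[OF assms] by (simp add: card_Diff_singleton)
qed

lemma cone_touch_k:
  assumes "x \<in> V - {v}" "y \<in> V - {v}" "x \<noteq> y" "c x y \<noteq> k"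
  shows "6 \<le> card ((nbr k x - {v}) \<union> (nbr k y - {v}))"
proof -
  have "7 \<le> card (nbr k x \<union> nbr k y)" using touch[of x y k] assms ijk by (auto simp: trio_def)
  moreover have "(nbr k x - {v}) \<union> (nbr k y - {v}) = (nbr k x \<union> nbr k y) - {v}" by auto
  ultimately show ?thesis using cone_apex_mem[OF assms(1)] by (simp add: card_Diff_singleton)
qed

text \<open>A vertex of \<open>X\<close> has at least 7 of its at most 8 fellows in \<open>X\<close>
  as neighbours in color \<open>l\<close>, so at most one in color \<open>k\<close>. The ends of an
  edge of color \<open>l\<close> in \<open>X\<close> share their outer neighbours in color
  \<open>k\<close>. With degrees at most 4 apart from \<open>v\<close>, the two cannot touch 6
  vertices.\<close>

lemma cone_small_cut:
  assumes "X \<subseteq> V - {v}" "X \<noteq> {}" "card X \<le> 9" "l \<in> {1, 2, 3}" "l \<noteq> k"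
    and cut: "\<And>a b. \<lbrakk>a \<in> X; b \<in> V - {v} - X\<rbrakk> \<Longrightarrow> c a b \<noteq> l"
  shows False
proof -
  define R where "R a = nbr k a - {v}" for a
  have fX: "finite X" using assms(1) finite_V by (meson finite_Diff finite_subset)
  have inX: "nbr l a \<subseteq> X - {a}" if "a \<in> X" for a
    using cone_degree(2)[of a l] cut[of a] that assms(1,4,5) by (auto simp: nbr_def)
  have inner: "card (R a \<inter> X) \<le> 1" if a: "a \<in> X" for a
  proof -
    have "R a \<inter> X \<subseteq> (X - {a}) - nbr l a" using assms(5) by (auto simp: R_def nbr_def)
    then have "card (R a \<inter> X) \<le> card ((X - {a}) - nbr l a)"
      by (rule card_mono[rotated]) (use fX in auto)
    also have "\<dots> = card X - 1 - card (nbr l a)"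
      using inX[OF a] a by (simp add: card_Diff_subset)
    finally show ?thesis using cone_degree(1)[of a l] subsetD[OF assms(1) a] assms(3-5) by linarith
  qed
  have split: "card (R a) = card (R a \<inter> X) + card (R a - X)" for a
    by (subst card_Un_disjoint[symmetric]) (auto simp: R_def intro: arg_cong[where f = card])
  obtain x where x: "x \<in> X" using assms by auto
  have "nbr l x \<noteq> {}" using cone_degree(1)[of x l] x assms by fastforce
  then obtain y where y: "y \<in> nbr l x" by auto
  then have yX: "y \<in> X" "y \<noteq> x" "c x y = l" using inX[OF x] by (auto simp: nbr_def)
  \<comment> \<open>Neither \<open>x z\<close> nor \<open>y z\<close> has color \<open>l\<close>,
    the color of \<open>x y\<close>; without rainbow triangles their colors agree.\<close>
  have eq: "z \<in> R x \<longleftrightarrow> z \<in> R y" if "z \<notin> X" for z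
  proof (cases "z \<in> V - {v}")
    case True
    have "c x z \<noteq> l" "c y z \<noteq> l" using cut x yX True that by auto
    moreover have "x \<noteq> z" "y \<noteq> z" using that x yX by auto
    ultimately have "c x z = c y z"
      using no_rainbow[of x y z] x yX assms(1) True by auto
    then show ?thesis using True \<open>x \<noteq> z\<close> \<open>y \<noteq> z\<close> by (auto simp: R_def nbr_def)
  next
    case False
    then show ?thesis by (auto simp: R_def nbr_def)
  qed
  then have out: "R x - X = R y - X" by auto
  have "R x \<union> R y = (R x \<inter> X) \<union> (R y \<inter> X) \<union> (R x - X)" using eq by auto
  then have "card (R x \<union> R y) = card ((R x \<inter> X) \<union> (R y \<inter> X) \<union> (R x - X))"
    by (rule arg_cong)
  then have "card (R x \<union> R y) \<le> card (R x \<inter> X) + card (R y \<inter> X) + card (R x - X)"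
    using card_Un_le[of "R x \<inter> X \<union> R y \<inter> X" "R x - X"] card_Un_le[of "R x \<inter> X" "R y \<inter> X"]
    by linarith
  moreover have "6 \<le> card (R x \<union> R y)"
    using cone_touch_k[of x y] x yX assms unfolding R_def by auto
  moreover have "card (R x) \<le> 4" "card (R y) \<le> 4"
    using cone_degree_k x yX assms(1) unfolding R_def by auto
  moreover have "card (R x \<inter> X) \<le> 1" "card (R y \<inter> X) \<le> 1" using inner x yX by auto
  ultimately show False using split[of x] split[of y] out by linarith
qed

end

lemma no_cone:
  assumes v: "v \<in> V" and k: "k \<in> {1, 2, 3}"
    and apex: "\<And>x. \<lbrakk>x \<in> V; x \<noteq> v\<rbrakk> \<Longrightarrow> c v x = k"
  shows False
proof -
  obtain i0 j0 where ij0: "trio i0 j0 k" using trio_exists k by blast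
  define A where "A = V - {v}"
  have AV: "A \<subseteq> V" and fA: "finite A" and cA: "card A = 19"
    using v card_V finite_V by (auto simp: A_def)
  obtain l x y where l: "l \<in> {1, 2, 3}" and xy: "x \<in> A" "y \<in> A" "(x, y) \<notin> conn l A"
    using disconnected_color[of A] AV cA by auto
  show False
  proof (cases "l = k")
    case False
    define X where "X = {z \<in> A. (x, z) \<in> conn l A}"
    have X: "X \<subseteq> A" "x \<in> X" "y \<in> A - X" using xy by (auto simp: X_def)
    have cut: "c a b \<noteq> l" if "a \<in> X" "b \<in> A - X" for a b
      using that conn_edge[of a A b l] conn_trans unfolding X_def by blast
    have "card X + card (A - X) = 19"
      using cA X fA by (metis card_Diff_subset card_mono finite_subset le_add_diff_inverse)
    then consider "card X \<le> 9" | "card (A - X) \<le> 9" by linarith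
    then show False
    proof cases
      case 1
      then show False
        using cone_small_cut[OF v ij0 apex, of X l] X cut l False unfolding A_def by blast
    next
      case 2
      have "A - (A - X) = X" using X by auto
      then show False
        using cone_small_cut[OF v ij0 apex, of "A - X" l] X cut l False 2 c_sym
        unfolding A_def by (metis Diff_subset empty_iff)
    qed
  next
    case True
    define R where "R a = nbr k a \<inter> A" for a
    have R: "R a = nbr k a - {v}" for a by (auto simp: R_def A_def nbr_def)
    have deg: "card (R a) \<le> 4" if "a \<in> A" for a
      using cone_degree_k[OF v ij0 apex, of a] that unfolding R A_def by blast
    have pair: "6 \<le> card (R a) + card (R b)" if "a \<in> A" "b \<in> A" "(a, b) \<notin> conn k A" for a b
    proof -
      have "a \<noteq> b" "c a b \<noteq> k" using that conn_edge by auto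
      then show ?thesis
        using cone_touch_k[OF v ij0 apex, of a b] that card_Un_le[of "R a" "R b"]
        unfolding R A_def by auto
    qed
    have low: "2 \<le> card (R a)" if a: "a \<in> A" for a
    proof -
      obtain b where "b \<in> A" "(a, b) \<notin> conn k A"
        using xy True conn_sym conn_trans by meson
      then show ?thesis using pair[of a b] deg[of b] a by linarith
    qed
    \<comment> \<open>\<open>P a\<close> and \<open>P b\<close> have at least 1 + 7 + 2 of the 19
      vertices each, so they share some \<open>z\<close>. Its edges to \<open>a\<close> and
      \<open>b\<close> have color \<open>j\<close> or \<open>k\<close>, hence the same color as
      \<open>c a b = i\<close>; it is not \<open>k\<close>, since that would connect
      \<open>a\<close> to \<open>b\<close>.\<close>
    have step: "\<exists>z\<in>A. c a z = j \<and> c b z = j \<and> (a, z) \<notin> conn k A \<and> (b, z) \<notin> conn k A"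
      if ijk: "trio i j k" and ab: "a \<in> A" "b \<in> A" "(a, b) \<notin> conn k A" "c a b = i" for i j a b
    proof -
      define P where "P t = insert t (nbr j t \<union> R t)" for t
      have jk: "j \<in> {1, 2, 3}" "i \<noteq> j" "i \<noteq> k" "j \<noteq> k" using ijk by (auto simp: trio_def)
      have P: "P t \<subseteq> A \<and> 10 \<le> card (P t)" if t: "t \<in> A" for t
      proof -
        have tv: "t \<in> V - {v}" using t by (simp add: A_def)
        have n: "7 \<le> card (nbr j t)" "nbr j t \<subseteq> A"
          using cone_degree[OF v ij0 apex tv jk(1,4)] unfolding A_def by blast+
        have "card (nbr j t \<union> R t) = card (nbr j t) + card (R t)"
          using jk(4) nbr_disjoint[of j k t] by (intro card_Un_disjoint) (auto simp: R_def)
        moreover have "card (P t) = card (nbr j t \<union> R t) + 1"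
          unfolding P_def by (subst card_insert_disjoint) (auto simp: R_def nbr_def finite_V)
        ultimately show ?thesis using n low[OF t] t by (auto simp: P_def R_def)
      qed
      have "P a \<inter> P b \<noteq> {}"
      proof
        assume "P a \<inter> P b = {}"
        then have "card (P a \<union> P b) = card (P a) + card (P b)"
          using P ab fA by (meson card_Un_disjoint finite_subset)
        moreover have "card (P a \<union> P b) \<le> 19"
          using P ab fA cA by (metis Un_least card_mono)
        ultimately show False using P[OF ab(1)] P[OF ab(2)] by linarith
      qed
      then obtain z where z: "z \<in> P a" "z \<in> P b" by auto
      have zA: "z \<in> A" using P z ab by blast
      have "c a z = j \<or> c a z = k" "c b z = j \<or> c b z = k"
        "a \<noteq> b" "z \<noteq> a" "z \<noteq> b"
        using z ab jk c_sym[of a b] unfolding P_def R_def nbr_def by auto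
      moreover have "\<not> (c a z = k \<and> c b z = k)"
        using conn_edge[of a A z k] conn_edge[of b A z k] zA ab conn_sym conn_trans by blast
      ultimately have cz: "c a z = j" "c b z = j"
        using no_rainbow[of a b z] ab zA AV jk by (auto dest: subsetD)
      have "(b, z) \<notin> conn k A" using nonconn_by_color[OF AV ab(1-3)] cz ab jk by auto
      moreover have "(a, z) \<notin> conn k A"
        using nonconn_by_color[OF AV ab(2,1), of k z] conn_sym ab cz jk c_sym[of a b] by auto
      ultimately show ?thesis using cz zA by blast
    qed
    have far: "(b, d) \<notin> conn k A"
      if "a \<in> A" "b \<in> A" "(a, b) \<notin> conn k A" "c a d \<noteq> c a b" for a b d
      using nonconn_by_color[OF AV] that by blast
    \<comment> \<open>Adding \<open>pair\<close> around the cycle \<open>p q r s t\<close> gives a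
      degree sum of at least 15, and 15 + 5 exceeds 19.\<close>
    have five: False
      if "{p, q, r, s, t} \<subseteq> A"
        "(p, q) \<notin> conn k A" "(p, r) \<notin> conn k A" "(p, s) \<notin> conn k A" "(p, t) \<notin> conn k A"
        "(q, r) \<notin> conn k A" "(q, s) \<notin> conn k A" "(q, t) \<notin> conn k A"
        "(r, s) \<notin> conn k A" "(r, t) \<notin> conn k A" "(s, t) \<notin> conn k A" for p q r s t
      using five_nonconn_sum[OF AV that] pair[of p q] pair[of q r] pair[of r s] pair[of s t]
        pair[of t p] that conn_sym[of t p] cA unfolding R_def[symmetric] by auto
    have xyn: "(x, y) \<notin> conn k A" using xy True by simp
    obtain i j where ij: "trio i j k" "c x y = i"
      using nonconn_color[OF AV xy(1,2) xyn ij0]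
      using ij0 trio_swap[OF ij0] that by blast
    have ji: "trio j i k" "i \<noteq> j" using trio_swap[OF ij(1)] trioD(4)[OF ij(1)] by auto
    \<comment> \<open>Three uses of \<open>step\<close> give \<open>z\<close>, \<open>w\<close> and
      \<open>u\<close>, the last from the edge \<open>x w\<close> or \<open>y z\<close> according to
      the color of \<open>y w\<close>. \<open>far\<close> separates \<open>w\<close> and
      \<open>u\<close> from the earlier vertices that \<open>step\<close> does not cover.\<close>
    obtain z where z: "z \<in> A" "c x z = j" "c y z = j" "(x, z) \<notin> conn k A" "(y, z) \<notin> conn k A"
      using step[OF ij(1) xy(1,2) xyn ij(2)] by blast
    obtain w where w: "w \<in> A" "c x w = i" "c z w = i" "(x, w) \<notin> conn k A" "(z, w) \<notin> conn k A"
      using step[OF ji(1) xy(1) z(1,4,2)] by blast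
    have yw: "(y, w) \<notin> conn k A"
      using far[of z y w] xy z w ji conn_sym[of z y] c_sym[of z y] by auto
    show False
    proof (cases "c y w = i")
      case True
      obtain u where u: "u \<in> A" "c x u = j" "c w u = j" "(x, u) \<notin> conn k A" "(w, u) \<notin> conn k A"
        using step[OF ij(1) xy(1) w(1,4,2)] by blast
      have "(y, u) \<notin> conn k A"
        using far[of w y u] xy w u yw True ji conn_sym[of w y] c_sym[of w y] by auto
      moreover have "(z, u) \<notin> conn k A"
        using far[of w z u] z w u ji conn_sym[of w z] c_sym[of w z] by auto
      ultimately show False
        using five[of x y z w u] xy(1,2) xyn z w u yw by blast
    next
      case False
      then have ywj: "c y w = j" using nonconn_color[OF AV xy(2) w(1) yw ij(1)] by blast
      obtain u where u: "u \<in> A" "c y u = i" "c z u = i" "(y, u) \<notin> conn k A" "(z, u) \<notin> conn k A"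
        using step[OF ji(1) xy(2) z(1,5,3)] by blast
      have "(x, u) \<notin> conn k A"
        using far[of z x u] xy z u ji conn_sym[of z x] c_sym[of z x] by auto
      moreover have "(w, u) \<notin> conn k A"
        using far[of y w u] xy w u yw ywj ji by auto
      ultimately show False
        using five[of x y z w u] xy(1,2) xyn z w u yw by blast
    qed
  qed
qed

section \<open>No proper vertex set sends edges of one color only to its complement\<close>

lemma no_small_mono_side:
  assumes BV: "B \<subseteq> V" and B2: "2 \<le> card B" and B10: "card B \<le> 10" and k: "k \<in> {1, 2, 3}"
    and out: "\<And>b a. \<lbrakk>b \<in> B; a \<in> V - B\<rbrakk> \<Longrightarrow> c b a = k"
  shows False
proof -
  have fB: "finite B" using BV finite_V finite_subset by blast
  have inB: "nbr l x \<subseteq> B" if "x \<in> B" "l \<noteq> k" for l x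
    using out[OF that(1)] that(2) by (auto simp: nbr_def)
  have touch_in: "7 \<le> card (nbr l x \<union> nbr l y)" "nbr l x \<union> nbr l y \<subseteq> B - {x, y}"
    if "x \<in> B" "y \<in> B" "x \<noteq> y" "l \<in> {1, 2, 3}" "l \<noteq> k" "c x y \<noteq> l" for x y l
  proof -
    have "x \<in> V" "y \<in> V" using that BV by auto
    then show "7 \<le> card (nbr l x \<union> nbr l y)" using touch that by blast
    have "x \<notin> nbr l x" "y \<notin> nbr l x" "x \<notin> nbr l y" "y \<notin> nbr l y"
      using that(6) c_sym[of x y] by (simp_all add: nbr_def)
    then show "nbr l x \<union> nbr l y \<subseteq> B - {x, y}" using inB[of x l] inB[of y l] that by blast
  qed
  have card2: "card (B - {x, y}) = card B - 2" if "x \<in> B" "y \<in> B" "x \<noteq> y" for x y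
    using that fB by (simp add: card_Diff_subset)
  obtain x0 y0 where xy0: "x0 \<in> B" "y0 \<in> B" "x0 \<noteq> y0"
    using B2 by (metis card_le_Suc0_iff_eq fB not_less_eq_eq numeral_2_eq_2)
  \<comment> \<open>In a color other than \<open>k\<close> and that of \<open>x0 y0\<close>, all
    touched vertices are further vertices of \<open>B\<close>.\<close>
  have B9: "9 \<le> card B"
  proof -
    obtain l :: nat where l: "l \<in> {1, 2, 3}" "l \<noteq> k" "l \<noteq> c x0 y0"
      using third_color[of k "c x0 y0"] by blast
    have "7 \<le> card (B - {x0, y0})"
      using touch_in[OF xy0 l(1,2)] l(3) card_mono[of "B - {x0, y0}"] fB
      by (metis finite_Diff le_trans)
    then show ?thesis using card2[OF xy0] by simp
  qed
  obtain i j where ijk: "trio i j k" using trio_exists k by blast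
  note tr = trioD[OF ijk]
  \<comment> \<open>Both \<open>i\<close> and \<open>j\<close> would require 7 touched vertices in
    \<open>B\<close>. The two sets are disjoint for lack of rainbow triangles, yet at most 8
    vertices are available.\<close>
  have not_k: "c x y \<noteq> k" if xy: "x \<in> B" "y \<in> B" "x \<noteq> y" for x y
  proof
    assume cxy: "c x y = k"
    have "(nbr i x \<union> nbr i y) \<inter> (nbr j x \<union> nbr j y) = {}"
      using no_rainbow[of x y] xy BV tr cxy by (fastforce simp: nbr_def)
    then have "card (nbr i x \<union> nbr i y) + card (nbr j x \<union> nbr j y)
      = card ((nbr i x \<union> nbr i y) \<union> (nbr j x \<union> nbr j y))"
      by (simp add: card_Un_disjoint)
    also have "\<dots> \<le> card (B - {x, y})"
      by (rule card_mono) (use fB touch_in(2)[OF xy] tr cxy in auto)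
    finally show False
      using touch_in(1)[OF xy, of i] touch_in(1)[OF xy, of j] tr cxy card2[OF xy] B10 by auto
  qed
  have two: "c x y = i \<or> c x y = j" if "x \<in> B" "y \<in> B" "x \<noteq> y" for x y
    using color_cases[of x y i j k] not_k[OF that] that BV ijk by auto
  define M where "M l x y = {z \<in> B - {x, y}. c x z = l \<and> c y z = l}" for l x y
  \<comment> \<open>At least 7 of the \<open>card B - 2\<close> other vertices are touched in the
    other color. So an edge of color \<open>l\<close> lies in no triangle of color \<open>l\<close>
    in \<open>B\<close> if \<open>B\<close> has 9 vertices, and in at most one if it has 10.\<close>
  have M: "card (M l x y) + 9 \<le> card B"
    if xy: "x \<in> B" "y \<in> B" "x \<noteq> y" "c x y = l" and l: "l \<in> {i, j}" for l x y
  proof -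
    define l' where "l' = (if l = i then j else i)"
    have l': "l' \<in> {1, 2, 3}" "l' \<noteq> k" "l' \<noteq> l" "c x y \<noteq> l'"
      using l tr(1-9) xy(4) by (simp_all add: l'_def split: if_splits)
    note t = touch_in[OF xy(1-3) l'(1,2,4)]
    have "M l x y \<inter> (nbr l' x \<union> nbr l' y) = {}" using l'(3) by (auto simp: M_def nbr_def)
    moreover have "finite (M l x y)" using fB by (simp add: M_def)
    ultimately have "card (M l x y) + card (nbr l' x \<union> nbr l' y)
      = card (M l x y \<union> (nbr l' x \<union> nbr l' y))"
      by (simp add: card_Un_disjoint)
    also have "\<dots> \<le> card (B - {x, y})"
      by (rule card_mono) (use fB t(2) in \<open>auto simp: M_def\<close>)
    finally show ?thesis using t(1) card2[OF xy(1-3)] B9 by linarith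
  qed
  have fM: "finite (M l x y)" for l x y using fB by (simp add: M_def)
  have M1: False
    if "x \<in> B" "y \<in> B" "z \<in> B" "w \<in> B" "distinct [x, y, z, w]" "l \<in> {i, j}" "c x y = l"
      "c x z = l" "c y z = l" "c x w = l" "c y w = l" for x y z w l
  proof -
    have "{z, w} \<subseteq> M l x y" using that by (auto simp: M_def)
    then have "card {z, w} \<le> card (M l x y)" by (rule card_mono[OF fM])
    then show False using M[of x y l] that B10 by auto
  qed
  have parts: "card (nbr i x0) + card (nbr j x0) = card B - 1"
  proof -
    have "nbr i x0 \<union> nbr j x0 = B - {x0}"
    proof
      show "nbr i x0 \<union> nbr j x0 \<subseteq> B - {x0}"
        using inB[OF xy0(1) tr(5)] inB[OF xy0(1) tr(6)] by (auto simp: nbr_def)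
      show "B - {x0} \<subseteq> nbr i x0 \<union> nbr j x0"
        using two[OF xy0(1)] BV by (auto simp: nbr_def)
    qed
    moreover have "nbr i x0 \<inter> nbr j x0 = {}" using tr nbr_disjoint by simp
    ultimately show ?thesis using xy0(1) fB
      by (metis card_Diff_singleton card_Un_disjoint finite_nbr)
  qed
  \<comment> \<open>\<open>l\<close> is a majority color at \<open>x0\<close>. With 9 vertices,
    three neighbours of \<open>x0\<close> in color \<open>l\<close> must form a triangle of color
    \<open>l'\<close>. With 10, there are five such neighbours; two edges of color \<open>l\<close>
    at one of them, or two triangles of color \<open>l'\<close> on a common edge, contradict
    \<open>M1\<close>.\<close>
  have big: False
    if l: "l \<in> {i, j}" "l' \<in> {i, j}" "l \<noteq> l'" and deg: "card B \<le> 2 * card (nbr l x0) + 1" for l l'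
  proof -
    have lB: "nbr l x0 \<subseteq> B" using inB[of x0 l] xy0 l tr by auto
    have other: "c p q = l' \<longleftrightarrow> c p q \<noteq> l" if "p \<in> B" "q \<in> B" "p \<noteq> q" for p q
      using two[OF that] l by auto
    show False
    proof (cases "card B = 9")
      case True
      then have "3 \<le> card (nbr l x0)" using deg by simp
      then obtain T where T: "T \<subseteq> nbr l x0" "card T = 3"
        by (rule obtain_subset_with_card_n)
      then obtain p q r where pqr: "T = {p, q, r}" "p \<noteq> q" "p \<noteq> r" "q \<noteq> r"
        using card_3_iff by metis
      then have mem: "p \<in> nbr l x0" "q \<in> nbr l x0" "r \<in> nbr l x0" using T by auto
      have none: "c s t = l'" if "s \<in> nbr l x0" "t \<in> nbr l x0" "s \<noteq> t" for s t
      proof (rule ccontr)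
        assume "c s t \<noteq> l'"
        moreover have st: "s \<in> B" "t \<in> B" "s \<noteq> x0" "t \<noteq> x0" "c x0 s = l" "c x0 t = l"
          using that lB by (auto simp: nbr_def)
        ultimately have "t \<in> M l x0 s" using other[of s t] that(3) by (simp add: M_def)
        moreover have "card (M l x0 s) = 0"
          using M[of x0 s l] xy0(1) st(1,3,5) l True by auto
        ultimately show False using fM by auto
      qed
      have memB: "p \<in> B" "q \<in> B" "r \<in> B" using mem lB by auto
      have "r \<in> M l' p q" using none[of p r] none[of q r] mem pqr(2-4) memB by (simp add: M_def)
      moreover have "card (M l' p q) = 0"
        using M[of p q l'] none[of p q] mem memB pqr(2) l True by auto
      ultimately show False using fM by auto
    next
      case False
      then have "card B = 10" using B9 B10 by simp
      then have "5 \<le> card (nbr l x0)" using deg by simp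
      then obtain T where T: "T \<subseteq> nbr l x0" "card T = 5"
        by (rule obtain_subset_with_card_n)
      have TB: "t \<in> B \<and> t \<noteq> x0 \<and> c x0 t = l" if "t \<in> T" for t
        using that T lB by (auto simp: nbr_def)
      show False
      proof (rule no_matching_on_five[OF T(2), of "\<lambda>x y. c x y = l"])
        show "c y x = l" if "c x y = l" for x y using that c_sym[of x y] by simp
        show False if "x \<in> T" "y \<in> T" "z \<in> T" "x \<noteq> y" "x \<noteq> z" "y \<noteq> z" "c x y = l" "c x z = l" for x y z
          using M1[of x0 x y z l] TB[of x] TB[of y] TB[of z] that xy0(1) l by auto
        show False if "x \<in> T" "y \<in> T" "z \<in> T" "w \<in> T" "distinct [x, y, z, w]"
          "c x y \<noteq> l" "c x z \<noteq> l" "c y z \<noteq> l" "c x w \<noteq> l" "c y w \<noteq> l" for x y z w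
          using M1[of x y z w l'] TB[of x] TB[of y] TB[of z] TB[of w] that l
            other[of x y] other[of x z] other[of y z] other[of x w] other[of y w] by auto
      qed
    qed
  qed
  have "card B \<le> 2 * card (nbr i x0) + 1 \<or> card B \<le> 2 * card (nbr j x0) + 1"
    using parts B9 by linarith
  then show False using big[of i j] big[of j i] tr by auto
qed

text \<open>One of the two sides has at most 10 vertices; a single vertex falls under
  \<open>no_cone\<close>.\<close>

lemma no_mono_cut:
  assumes "B \<subseteq> V" "B \<noteq> {}" "B \<noteq> V" and k: "k \<in> {1, 2, 3}"
    and out: "\<And>b a. \<lbrakk>b \<in> B; a \<in> V - B\<rbrakk> \<Longrightarrow> c b a = k"
  shows False
proof -
  have small: False
    if "X \<subseteq> V" "X \<noteq> {}" "card X \<le> 10" "\<And>b a. \<lbrakk>b \<in> X; a \<in> V - X\<rbrakk> \<Longrightarrow> c b a = k" for X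
  proof (cases "2 \<le> card X")
    case True
    then show False using no_small_mono_side[of X k] that k by blast
  next
    case False
    have "finite X" using that finite_V finite_subset by blast
    then have "card X = 1" using False that by (metis One_nat_def Suc_leI card_gt_0_iff le_less_Suc_eq
          linorder_not_less numeral_2_eq_2)
    then obtain v where "X = {v}" using card_1_singletonE by blast
    then show False using no_cone[of v k] that k by auto
  qed
  have fB: "finite B" using assms finite_V finite_subset by blast
  have "card B + card (V - B) = 20"
    using assms card_V finite_V fB by (metis card_Diff_subset card_mono le_add_diff_inverse)
  then consider "card B \<le> 10" | "card (V - B) \<le> 10" by linarith
  then show False
  proof cases
    case 1
    then show False using small[of B] assms by blast
  next
    case 2
    have "V - (V - B) = B" using assms by auto
    moreover have "c b a = k" if "b \<in> V - B" "a \<in> B" for a b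
      using out[of a b] that c_sym[of a b] by simp
    ultimately show False using small[of "V - B"] 2 assms by (metis Diff_eq_empty_iff Diff_subset subset_antisym)
  qed
qed

section \<open>The components of a disconnected color on all 20 vertices\<close>

lemma no_touching_coloring: False
proof -
  obtain k x0 y0 where k: "k \<in> {1, 2, 3}" and xy0: "x0 \<in> V" "y0 \<in> V" "(x0, y0) \<notin> conn k V"
    using disconnected_color[of V] card_V by auto
  obtain i0 j0 where ij0: "trio i0 j0 k" using trio_exists k by blast
  define C where "C t = {z \<in> V. (t, z) \<in> conn k V}" for t
  have CV: "C t \<subseteq> V" "finite (C t)" for t using finite_V by (auto simp: C_def)
  have nbrV: "nbr l t \<inter> V = nbr l t" for l t by (auto simp: nbr_def)
  have nbrC: "nbr k t \<subseteq> C t" if "t \<in> V" for t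
    using nbr_conn[OF that, of k] by (auto simp: C_def nbr_def)
  have pair: "7 \<le> card (nbr k a) + card (nbr k b)"
    if "a \<in> V" "b \<in> V" "(a, b) \<notin> conn k V" for a b
  proof -
    have "a \<noteq> b" "c a b \<noteq> k" using that conn_edge by auto
    then show ?thesis using touch_sum that k by blast
  qed
  have degC: "card (nbr k t) + 1 \<le> card (C t)" if t: "t \<in> V" for t
  proof -
    have "insert t (nbr k t) \<subseteq> C t" using nbrC t by (auto simp: C_def)
    then have "card (insert t (nbr k t)) \<le> card (C t)" by (rule card_mono[OF CV(2)])
    then show ?thesis by (simp add: nbr_def finite_V)
  qed
  have pairC: "9 \<le> card (C a) + card (C b)"
    if "a \<in> V" "b \<in> V" "(a, b) \<notin> conn k V" for a b
    using pair[OF that] degC[OF that(1)] degC[OF that(2)] by linarith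
  have disjC: "C a \<inter> C b = {}" if "(a, b) \<notin> conn k V" for a b
  proof -
    have "(a, b) \<in> conn k V" if "(a, z) \<in> conn k V" "(b, z) \<in> conn k V" for z
      by (rule conn_trans[OF that(1) conn_sym[OF that(2)]])
    then show ?thesis using that by (auto simp: C_def)
  qed
  \<comment> \<open>Around the cycle of five vertices, twice the degree sum is at least 35, which
    leaves too little room in 20 vertices.\<close>
  have five: False
    if "{p, q, r, s, t} \<subseteq> V"
      "(p, q) \<notin> conn k V" "(p, r) \<notin> conn k V" "(p, s) \<notin> conn k V" "(p, t) \<notin> conn k V"
      "(q, r) \<notin> conn k V" "(q, s) \<notin> conn k V" "(q, t) \<notin> conn k V"
      "(r, s) \<notin> conn k V" "(r, t) \<notin> conn k V" "(s, t) \<notin> conn k V" for p q r s t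
    using five_nonconn_sum[OF subset_refl that] pair[of p q] pair[of q r] pair[of r s] pair[of s t]
      pair[of p t] that card_V unfolding nbrV by auto
  \<comment> \<open>Otherwise all edges leaving \<open>C t\<close> would have color
    \<open>l\<close>, a monochromatic cut.\<close>
  have other: "\<exists>z\<in>V. (t, z) \<notin> conn k V \<and> c t z \<noteq> l"
    if t: "t \<in> V" "s \<in> V" "(t, s) \<notin> conn k V" and l: "l \<in> {1, 2, 3}" for t s l
  proof (rule ccontr)
    assume none: "\<not> ?thesis"
    have "c b a = l" if "b \<in> C t" "a \<in> V - C t" for a b
    proof -
      have "a \<in> V" "(t, a) \<notin> conn k V" "(t, b) \<in> conn k V" using that by (auto simp: C_def)
      then have "c b a = c t a" "c t a = l"
        using color_constant2[OF subset_refl t(1), of a k b a] none by auto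
      then show ?thesis by simp
    qed
    moreover have "t \<in> C t" "s \<notin> C t" using t by (auto simp: C_def)
    ultimately show False using no_mono_cut[of "C t" l] CV(1)[of t] t(2) l by blast
  qed
  have main: False
    if ijk: "trio i j k" and xyz: "x \<in> V" "y \<in> V" "z \<in> V"
      and n: "(x, y) \<notin> conn k V" "(x, z) \<notin> conn k V" "(y, z) \<notin> conn k V"
      and col: "c x y = i" "c x z = j" "c y z = i" for x y z i j
  proof -
    note tr = trioD[OF ijk]
    \<comment> \<open>Since \<open>y\<close> sees both \<open>x\<close> and \<open>z\<close> in
      color \<open>i\<close> but not \<open>w\<close>, this \<open>w\<close> lies in a fourth
      component.\<close>
    obtain w where w: "w \<in> V" "(y, w) \<notin> conn k V" "c y w \<noteq> i"
      using other[OF xyz(2,3) n(3) tr(1)] by blast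
    have yx: "(y, x) \<notin> conn k V" "c y x = i" using n(1) conn_sym[of y x] col(1) c_sym[of y x] by auto
    have xw: "(x, w) \<notin> conn k V" using nonconn_by_color[OF subset_refl xyz(2,1) yx(1)] yx(2) w(3) by simp
    have zw: "(z, w) \<notin> conn k V" using nonconn_by_color[OF subset_refl xyz(2,3) n(3)] col(3) w(3) by simp
    have cover: "\<exists>r\<in>{x, y, z, w}. v \<in> C r" if "v \<in> V" for v
      using five[of x y z w v] xyz w(1,2) n xw zw that unfolding C_def by blast
    have "card (C x) + card (C y) + card (C z) + card (C w) + card ({} :: 'a set) \<le> card V"
      by (rule sum_card_disjoint_five[OF finite_V]) (use CV disjC n xw zw w in auto)
    then have total: "card (C x) + card (C y) + card (C z) + card (C w) \<le> 20" using card_V by simp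
    note p = pairC[OF xyz(1,2) n(1)] pairC[OF xyz(1,3) n(2)] pairC[OF xyz(2,3) n(3)]
      pairC[OF xyz(1) w(1) xw] pairC[OF xyz(2) w(1,2)] pairC[OF xyz(3) w(1) zw]
    \<comment> \<open>The three pairs among the other components add up to at least 27, so those
      components have at least 14 vertices together.\<close>
    have six: "card (C x) \<le> 6" "card (C y) \<le> 6" "card (C z) \<le> 6" "card (C w) \<le> 6"
      using p total by linarith+
    have clique: "c a b = k" if ab: "a \<in> C x" "b \<in> C x" "a \<noteq> b" for a b
    proof (rule ccontr)
      assume nk: "c a b \<noteq> k"
      have V: "a \<in> V" "b \<in> V" using ab by (auto simp: C_def)
      have "C a \<subseteq> C x" "C b \<subseteq> C x" using ab conn_trans[of x _ k V] unfolding C_def by blast+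
      then have "nbr k a \<union> nbr k b \<subseteq> C x" using nbrC V by blast
      then have "card (nbr k a \<union> nbr k b) \<le> 6" using six(1) card_mono[OF CV(2)] le_trans by blast
      then show False using touch[OF V ab(3) k nk] by linarith
    qed
    have "\<not> C x \<subseteq> {x}" using p(1) six(2) card_mono[of "{x}" "C x"] by auto
    then obtain x' where x': "x' \<in> C x" "x' \<noteq> x" by blast
    have xC: "x \<in> C x" using xyz by (simp add: C_def)
    have x'V: "x' \<in> V" "(x, x') \<in> conn k V" using x' by (auto simp: C_def)
    have cx': "c x x' = k" using clique[OF xC x'(1)] x'(2) by simp
    \<comment> \<open>Edges between two components have a single color, so a vertex touched in color
      \<open>l\<close> lies in a component that \<open>x\<close> sees in color
      \<open>l\<close>.\<close>
    have outer: "\<exists>r\<in>{y, z, w}. s \<in> C r \<and> c x r = l"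
      if l: "l \<noteq> k" and s: "s \<in> nbr l x \<union> nbr l x'" for l s
    proof -
      have sV: "s \<in> V" using s by (auto simp: nbr_def)
      have "s \<notin> C x" using s l clique[of x s] clique[of x' s] xC x' by (auto simp: nbr_def)
      then obtain r where r: "r \<in> {y, z, w}" "s \<in> C r" using cover[OF sV] by blast
      have nr: "r \<in> V" "(x, r) \<notin> conn k V" "(r, s) \<in> conn k V"
        using r xyz w(1) n xw by (auto simp: C_def)
      have "c x s = c x r" "c x' s = c x r"
        using color_constant2[OF subset_refl xyz(1) nr(1,2) _ nr(3)] x'V(2) by simp_all
      then have "c x r = l" using s by (auto simp: nbr_def)
      then show ?thesis using r by blast
    qed
    have bound: "7 \<le> card (nbr l x \<union> nbr l x')" if "l \<in> {1, 2, 3}" "l \<noteq> k" for l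
      using touch[OF xyz(1) x'V(1) x'(2)[symmetric] that(1)] cx' that(2) by simp
    have few: False if "l \<in> {1, 2, 3}" "l \<noteq> k" "nbr l x \<union> nbr l x' \<subseteq> C r" "card (C r) \<le> 6" for l r
      using bound[OF that(1,2)] card_mono[OF CV(2) that(3)] that(4) by linarith
    consider "c x w = i" | "c x w = j" using nonconn_color[OF subset_refl xyz(1) w(1) xw ijk] by blast
    then show False
    proof cases
      case 1
      have "nbr j x \<union> nbr j x' \<subseteq> C z"
      proof
        fix s assume "s \<in> nbr j x \<union> nbr j x'"
        then obtain r where "r \<in> {y, z, w}" "s \<in> C r" "c x r = j" using outer[OF tr(6)] by blast
        then show "s \<in> C z" using col(1) 1 tr(4) by auto
      qed
      then show False using few[OF tr(2,6)] six(3) by blast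
    next
      case 2
      have "nbr i x \<union> nbr i x' \<subseteq> C y"
      proof
        fix s assume "s \<in> nbr i x \<union> nbr i x'"
        then obtain r where "r \<in> {y, z, w}" "s \<in> C r" "c x r = i" using outer[OF tr(5)] by blast
        then show "s \<in> C y" using col(2) 2 tr(4) by auto
      qed
      then show False using few[OF tr(1,5)] six(2) by blast
    qed
  qed
  \<comment> \<open>Both other colors leave the component of \<open>x0\<close>. The color of
    \<open>y z\<close> decides which of \<open>y\<close> and \<open>z\<close> takes the place of the
    vertex \<open>y\<close> in \<open>main\<close>.\<close>
  obtain y where y: "y \<in> V" "(x0, y) \<notin> conn k V" "c x0 y \<noteq> i0"
    using other[OF xy0 trioD(1)[OF ij0]] by blast
  obtain z where z: "z \<in> V" "(x0, z) \<notin> conn k V" "c x0 z \<noteq> j0"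
    using other[OF xy0 trioD(2)[OF ij0]] by blast
  have cy: "c x0 y = j0" using nonconn_color[OF subset_refl xy0(1) y(1,2) ij0] y(3) by blast
  have cz: "c x0 z = i0" using nonconn_color[OF subset_refl xy0(1) z(1,2) ij0] z(3) by blast
  have yz: "(y, z) \<notin> conn k V"
    using nonconn_by_color[OF subset_refl xy0(1) y(1,2), of z] cy z(3) by simp
  then have zy: "(z, y) \<notin> conn k V" using conn_sym by blast
  consider "c y z = i0" | "c y z = j0" using nonconn_color[OF subset_refl y(1) z(1) yz ij0] by blast
  then show False
  proof cases
    case 1
    then show False using main[OF ij0 xy0(1) z(1) y(1) z(2) y(2) zy cz cy] c_sym[of z y] by simp
  next
    case 2
    then show False using main[OF trio_swap[OF ij0] xy0(1) y(1) z(1) y(2) z(2) yz cy cz] by simp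
  qed
qed

end

section \<open>Copies of the book, and the upper bound\<close>

lemma vertices_book: "vertices (book n) = {Inl 0, Inl 1} \<union> Inr ` {..<n}"
  by (auto simp: book_def graph_join_def complete_graph_def empty_graph_def less_2_cases_iff Plus_def)

lemma edges_book:
  "edges (book n) = insert {Inl 0, Inl 1} ((\<lambda>i. {Inl 0, Inr i}) ` {..<n} \<union> (\<lambda>i. {Inl 1, Inr i}) ` {..<n})"
proof -
  have "all_pairs {..<2::nat} = {{0, 1}}"
    by (auto simp: all_pairs_def less_2_cases_iff insert_commute)
  moreover have "{{Inl u, Inr v} |u v. u < (2::nat) \<and> v < n}
      = (\<lambda>i. {Inl 0, Inr i}) ` {..<n} \<union> (\<lambda>i. {Inl 1, Inr i}) ` {..<n}"
    by (auto simp: less_2_cases_iff)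
  ultimately show ?thesis
    by (simp add: book_def graph_join_def complete_graph_def empty_graph_def)
qed

definition book_edges :: "'a \<Rightarrow> 'a \<Rightarrow> 'a set \<Rightarrow> 'a set set" where
  "book_edges x y Z = insert {x, y} ((\<lambda>z. {x, z}) ` Z \<union> (\<lambda>z. {y, z}) ` Z)"

lemma doubleton_in_all_pairs: "{u, v} \<in> all_pairs V \<longleftrightarrow> u \<in> V \<and> v \<in> V \<and> u \<noteq> v"
  by (auto simp: all_pairs_def doubleton_eq_iff)

text \<open>Replaces isomorphisms by a spine and a page set, so that both bounds become counts of
  pages. Conversely, an enumeration \<open>h\<close> of \<open>Z\<close> extends to an
  isomorphism.\<close>

lemma has_copy_book_iff:
  "has_copy_with_colors s (book n) p f \<longleftrightarrow>
    (\<exists>x y Z. x < p \<and> y < p \<and> x \<noteq> y \<and> Z \<subseteq> {..<p} - {x, y} \<and> card Z = n \<and> finite Z \<and>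
      card (f ` book_edges x y Z) \<le> s)" (is "?L \<longleftrightarrow> ?R")
proof
  assume ?L
  then obtain H \<phi> where H: "subgraph H (complete_graph p)" "card (f ` edges H) \<le> s"
    and bij: "bij_betw \<phi> (vertices (book n)) (vertices H)"
    and edges: "edges H = (\<lambda>e. \<phi> ` e) ` edges (book n)"
    unfolding has_copy_with_colors_def isomorphic_def by blast
  define Z where "Z = (\<lambda>i. \<phi> (Inr i)) ` {..<n}"
  have inj: "inj_on \<phi> (vertices (book n))" using bij by (rule bij_betw_imp_inj_on)
  have "\<phi> ` vertices (book n) = vertices H" using bij by (rule bij_betw_imp_surj_on)
  then have sub: "\<phi> ` vertices (book n) \<subseteq> {..<p}"
    using H(1) by (simp add: subgraph_def complete_graph_def)
  have ne: "\<phi> (Inl 0) \<noteq> \<phi> (Inl 1)"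
    using inj_onD[OF inj, of "Inl 0" "Inl 1"] by (auto simp: vertices_book)
  have Zsub: "Z \<subseteq> {..<p} - {\<phi> (Inl 0), \<phi> (Inl 1)}"
    using sub inj by (auto simp: Z_def vertices_book inj_on_def)
  have "inj_on (\<lambda>i. \<phi> (Inr i)) {..<n}"
    using inj by (auto simp: inj_on_def vertices_book)
  then have "card Z = n" by (simp add: Z_def card_image)
  moreover have "edges H = book_edges (\<phi> (Inl 0)) (\<phi> (Inl 1)) Z"
    by (simp add: edges edges_book book_edges_def Z_def image_Un image_image)
  moreover have "\<phi> (Inl 0) < p" "\<phi> (Inl 1) < p" using sub by (auto simp: vertices_book)
  ultimately show ?R using ne Zsub H(2) by (intro exI[of _ "\<phi> (Inl 0)"] exI[of _ "\<phi> (Inl 1)"] exI[of _ Z]) (auto simp: Z_def)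
next
  assume ?R
  then obtain x y Z where xy: "x < p" "y < p" "x \<noteq> y" and Z: "Z \<subseteq> {..<p} - {x, y}" "card Z = n"
    "finite Z" and few: "card (f ` book_edges x y Z) \<le> s" by blast
  obtain h where h: "bij_betw h {..<n} Z"
    using ex_bij_betw_nat_finite[OF Z(3)] Z(2) by (auto simp: lessThan_atLeast0)
  then have hZ: "h ` {..<n} = Z" by (rule bij_betw_imp_surj_on)
  define \<phi> where "\<phi> = case_sum (\<lambda>i. if i = (0::nat) then x else y) h"
  define H where "H = (insert x (insert y Z), book_edges x y Z)"
  have "bij_betw \<phi> (vertices (book n)) (vertices H)"
    unfolding bij_betw_def
  proof
    show "inj_on \<phi> (vertices (book n))"
      using bij_betw_imp_inj_on[OF h] xy(3) Z(1) hZ by (auto simp: inj_on_def vertices_book \<phi>_def)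
    show "\<phi> ` vertices (book n) = vertices H"
      by (simp add: vertices_book \<phi>_def H_def image_Un image_image hZ)
  qed
  moreover have "edges H = (\<lambda>e. \<phi> ` e) ` edges (book n)"
    by (simp add: edges_book book_edges_def H_def \<phi>_def image_Un image_image flip: hZ)
  moreover have "subgraph H (complete_graph p)"
    using xy Z(1)
    by (auto simp: subgraph_def simple_graph_def H_def complete_graph_def book_edges_def
        doubleton_in_all_pairs)
  moreover have "card (f ` edges H) \<le> s" using few by (simp add: H_def)
  ultimately show ?L unfolding has_copy_with_colors_def isomorphic_def by blast
qed

lemma edges_complete_graph: "x < p \<Longrightarrow> y < p \<Longrightarrow> x \<noteq> y \<Longrightarrow> {x, y} \<in> edges (complete_graph p)"
  by (simp add: complete_graph_def doubleton_in_all_pairs)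

lemma book_20:
  assumes "gallai_coloring 3 20 f"
  shows "has_copy_with_colors 2 (book 12) 20 f"
proof (rule ccontr)
  assume no: "\<not> ?thesis"
  define c where "c x y = f {x, y}" for x y
  interpret gallai_three "{..<20}" c
  proof
    show "c x y = c y x" for x y by (simp add: c_def insert_commute)
    show "c x y \<in> {1, 2, 3}" if "x \<in> {..<20}" "y \<in> {..<20}" "x \<noteq> y" for x y
    proof -
      have "f {x, y} \<in> {1..3}"
        using assms that edges_complete_graph[of x 20 y] unfolding gallai_coloring_def coloring_def by auto
      then show ?thesis unfolding c_def by auto
    qed
    show "c x y = c x z \<or> c x y = c y z \<or> c x z = c y z"
      if "x \<in> {..<20}" "y \<in> {..<20}" "z \<in> {..<20}" "x \<noteq> y" "x \<noteq> z" "y \<noteq> z" for x y z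
      using assms that unfolding gallai_coloring_def rainbow_triangle_def c_def complete_graph_def
      by auto
  qed simp
  interpret touching_coloring "{..<20}" c
  proof
    fix x y k
    assume xy: "x \<in> {..<20}" "y \<in> {..<20}" "x \<noteq> y" and k: "k \<in> {1, 2, 3}" "c x y \<noteq> k"
    show "7 \<le> card (nbr k x \<union> nbr k y)"
    proof (rule ccontr)
      assume small: "\<not> ?thesis"
      \<comment> \<open>With at most 6 touched vertices, at least 18 - 6 = 12 remain, and a book
        with these pages misses color \<open>k\<close>.\<close>
      define Z where "Z = {..<20} - {x, y} - (nbr k x \<union> nbr k y)"
      have "card ({..<20} - {x, y}) = 18" using xy by (simp add: card_Diff_subset)
      then have "12 \<le> card Z"
        using small diff_card_le_card_Diff[of "nbr k x \<union> nbr k y" "{..<20} - {x, y}"]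
        by (simp add: Z_def)
      then obtain Z' where Z': "Z' \<subseteq> Z" "card Z' = 12" "finite Z'"
        by (rule obtain_subset_with_card_n)
      have "f ` book_edges x y Z' \<subseteq> {1, 2, 3} - {k}"
      proof -
        have "f {x, y} \<in> {1, 2, 3} - {k}" using c_range[OF xy] k by (auto simp: c_def)
        moreover have "f {a, z} \<in> {1, 2, 3} - {k}" if "a \<in> {x, y}" "z \<in> Z'" for a z
        proof -
          have z: "z < 20" "z \<noteq> a" "z \<notin> nbr k a" using that Z'(1) by (auto simp: Z_def)
          moreover have "a < 20" using that xy by auto
          ultimately show ?thesis using c_range[of a z] by (auto simp: nbr_def c_def)
        qed
        ultimately show ?thesis by (auto simp: book_edges_def)
      qed
      then have "card (f ` book_edges x y Z') \<le> card ({1, 2, 3} - {k})"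
        by (rule card_mono[rotated]) simp
      also have "\<dots> = 2" using k by auto
      finally show False
        using no xy Z' unfolding has_copy_book_iff Z_def by blast
    qed
  qed simp
  show False by (rule no_touching_coloring)
qed

section \<open>The extremal coloring of 19 vertices, and the lower bound\<close>

text \<open>Truncated subtraction makes \<open>x - y + (y - x)\<close> the distance of \<open>x\<close> and \<open>y\<close>.\<close>

definition extremal :: "nat \<Rightarrow> nat \<Rightarrow> nat" where
  "extremal x y =
    (if x < 9 \<and> y < 9 then if x div 3 = y div 3 \<or> x mod 3 = y mod 3 then 1 else 2
     else if x < 9 \<or> y < 9 then 3
     else if x - y + (y - x) \<in> {1, 3, 4, 9} then 1 else 2)"

lemma extremal_sym: "extremal x y = extremal y x"
  by (auto simp: extremal_def add.commute)

text \<open>A finite check by evaluation, halved by \<open>y < x\<close>. The distances 1, 3, 4, 9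
  are the nonzero squares modulo 13 up to 9, the largest distance among the vertices 9 to 18; the
  squares 10 and 12 cannot occur.\<close>

lemma extremal_pages_lists:
  "\<forall>x\<in>set [0..<19]. \<forall>y\<in>set [0..<x]. \<forall>k\<in>set [1, 2, 3]. extremal x y \<noteq> k \<longrightarrow>
    length (filter (\<lambda>z. z \<noteq> x \<and> z \<noteq> y \<and> extremal x z \<noteq> k \<and> extremal y z \<noteq> k) [0..<19]) \<le> 11"
  by code_simp

lemma extremal_pages:
  assumes "x < 19" "y < 19" "x \<noteq> y" "k \<in> {1, 2, 3}" "extremal x y \<noteq> k"
  shows "card {z. z < 19 \<and> z \<noteq> x \<and> z \<noteq> y \<and> extremal x z \<noteq> k \<and> extremal y z \<noteq> k} \<le> 11"
  using assms
proof (induction x y rule: linorder_wlog)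
  case (sym a b)
  have "{z. z < 19 \<and> z \<noteq> a \<and> z \<noteq> b \<and> extremal a z \<noteq> k \<and> extremal b z \<noteq> k}
    = {z. z < 19 \<and> z \<noteq> b \<and> z \<noteq> a \<and> extremal b z \<noteq> k \<and> extremal a z \<noteq> k}" by blast
  then show ?case using sym extremal_sym[of a b] by simp
next
  case (le a b)
  let ?P = "\<lambda>z. z \<noteq> b \<and> z \<noteq> a \<and> extremal b z \<noteq> k \<and> extremal a z \<noteq> k"
  have "b \<in> set [0..<19]" "a \<in> set [0..<b]" "k \<in> set [1, 2, 3]" "extremal b a \<noteq> k"
    using le extremal_sym[of a b] by auto
  then have "length (filter ?P [0..<19]) \<le> 11" using extremal_pages_lists by blast
  with card_length have "card (set (filter ?P [0..<19])) \<le> 11" by (rule le_trans)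
  moreover have "set (filter ?P [0..<19])
    = {z. z < 19 \<and> z \<noteq> a \<and> z \<noteq> b \<and> extremal a z \<noteq> k \<and> extremal b z \<noteq> k}" by auto
  ultimately show ?case by (simp only:)
qed

definition extremal_coloring :: "nat set \<Rightarrow> nat" where
  "extremal_coloring e = extremal (Min e) (Max e)"

lemma extremal_coloring_pair: "extremal_coloring {x, y} = extremal x y"
  using extremal_sym[of x y] by (cases "x \<le> y") (simp_all add: extremal_coloring_def max_def min_def)

lemma extremal_gallai: "gallai_coloring 3 p extremal_coloring"
proof -
  have "extremal_coloring e \<in> {1..3}" for e
    by (simp add: extremal_coloring_def extremal_def)
  moreover have "\<not> rainbow_triangle extremal_coloring x y z" for x y z
  proof -
    have range: "extremal a b = 1 \<or> extremal a b = 2 \<or> extremal a b = 3" for a b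
      by (simp add: extremal_def)
    \<comment> \<open>Color 3 is a cut, so a triangle has none or two of its edges in it; in both
      cases a color repeats.\<close>
    have cross: "extremal a b = 3 \<longleftrightarrow> (a < 9) \<noteq> (b < 9)" for a b
      by (simp add: extremal_def)
    show ?thesis
      unfolding rainbow_triangle_def extremal_coloring_pair
      using range[of x y] range[of x z] range[of y z] cross[of x y] cross[of x z] cross[of y z]
      by (elim disjE; auto)
  qed
  ultimately show ?thesis by (simp add: gallai_coloring_def coloring_def)
qed

text \<open>Minimality asks for a counterexample at every smaller order; the restrictions of one
  coloring supply them. Two colors leave out some \<open>k\<close>, so all pages are among those
  counted in \<open>extremal_pages\<close>.\<close>

lemma extremal_no_book:
  assumes "p \<le> 19"
  shows "\<not> has_copy_with_colors 2 (book 12) p extremal_coloring"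
proof
  assume "has_copy_with_colors 2 (book 12) p extremal_coloring"
  then obtain x y Z where xy: "x < p" "y < p" "x \<noteq> y" and Z: "Z \<subseteq> {..<p} - {x, y}" "card Z = 12"
    and few: "card (extremal_coloring ` book_edges x y Z) \<le> 2" (is "card ?I \<le> 2")
    unfolding has_copy_book_iff by blast
  have "\<exists>k\<in>{1, 2, 3}. k \<notin> ?I"
  proof (rule ccontr)
    assume "\<not> ?thesis"
    then have "{1, 2, 3} \<subseteq> ?I" by auto
    moreover have "finite ?I"
      using finite_subset[OF Z(1)] by (simp add: book_edges_def)
    ultimately have "card {1, 2, 3::nat} \<le> card ?I" by (rule card_mono[rotated])
    then show False using few by simp
  qed
  then obtain k where k: "k \<in> {1, 2, 3}" "k \<notin> ?I" by blast
  have xyk: "extremal x y \<noteq> k" using k(2) by (auto simp: book_edges_def extremal_coloring_pair)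
  let ?Z = "{z. z < 19 \<and> z \<noteq> x \<and> z \<noteq> y \<and> extremal x z \<noteq> k \<and> extremal y z \<noteq> k}"
  have "z \<in> ?Z" if "z \<in> Z" for z
  proof -
    have "extremal x z \<in> ?I" "extremal y z \<in> ?I"
      using imageI[of "{x, z}" _ extremal_coloring] imageI[of "{y, z}" _ extremal_coloring] that
      by (auto simp: book_edges_def extremal_coloring_pair)
    then show ?thesis using that Z(1) assms k(2) by auto
  qed
  then have "Z \<subseteq> ?Z" by blast
  moreover have "finite ?Z" by simp
  ultimately have "card Z \<le> card ?Z" by (rule card_mono[rotated])
  then show False using extremal_pages[of x y k] xy assms k(1) xyk Z(2) by simp
qed

theorem theorem4p8:
  shows "weakened_gallai_ramsey 3 2 (book 12) = 20"
  unfolding weakened_gallai_ramsey_def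
proof (rule Least_equality)
  show "\<forall>f. gallai_coloring 3 20 f \<longrightarrow> has_copy_with_colors 2 (book 12) 20 f"
    using book_20 by blast
  show "20 \<le> p" if "\<forall>f. gallai_coloring 3 p f \<longrightarrow> has_copy_with_colors 2 (book 12) p f" for p
  proof -
    have "\<not> p \<le> 19" using that extremal_gallai extremal_no_book[of p] by blast
    then show ?thesis by simp
  qed
qed

end
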